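(* Let $n\ge 1$, let $T_i, S_i\in\mathcal{B}_A(\mathcal{H})$ for $1\le i\le n$, and, when $n$ is odd, assume $T_{\frac{n+1}{2}}=S_{\frac{n+1}{2}}$. Let $\mathbb{T}$ be the $n\times n$ cross-diagonal operator matrix on $\bigoplus_{i=1}^n\mathcal{H}$ whose $(i,i)$ entry is $T_i$ and whose $(i,n+1-i)$ entry is $S_i$ for $1\le i\le n$ (when $n$ is odd the central entry is the common operator $T_{\frac{n+1}{2}}=S_{\frac{n+1}{2}}$), all other entries being $O$. (i) If $n$ is even, then $$w_{\mathbb{A}}(\mathbb{T})=\max_{1\le i\le \frac n2} w_{\mathbb{A}}\left(\begin{bmatrix} T_{n-(2i-1)} & S_{n-(2i-1)}\\ S_{2i} & T_{2i}\end{bmatrix}\right).$$ (ii) If $n$ and $\frac{n+1}{2}$ are odd, then $$w_{\mathbb{A}}(\mathbb{T})=\max\left\{\max_{1\le i\le \frac{n-1}{4}} w_{\mathbb{A}}\left(\begin{bmatrix} T_{n-(2i-1)} & S_{n-(2i-1)}\\ S_{2i} & T_{2i}\end{bmatrix}\right),\ w_A\big(T_{\frac{n+1}{2}}\big),\ \max_{\frac{n+7}{4}\le i\le \frac{n+1}{2}} w_{\mathbb{A}}\left(\begin{bmatrix} T_{n-(2i-2)} & S_{n-(2i-2)}\\ S_{2i-1} & T_{2i-1}\end{bmatrix}\right)\right\}.$$ (iii) If $n$ is odd but $\frac{n+1}{2}$ is even, then $$w_{\mathbb{A}}(\mathbb{T})=\max\left\{\max_{1\le i\le \frac{n-3}{4}}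 w_{\mathbb{A}}\left(\begin{bmatrix} T_{n-(2i-1)} & S_{n-(2i-1)}\\ S_{2i} & T_{2i}\end{bmatrix}\right),\ w_A\big(T_{\frac{n+1}{2}}\big),\ \max_{\frac{n+5}{4}\le i\le \frac{n+1}{2}} w_{\mathbb{A}}\left(\begin{bmatrix} T_{n-(2i-2)} & S_{n-(2i-2)}\\ S_{2i-1} & T_{2i-1}\end{bmatrix}\right)\right\}.$$ A maximum over an empty range of $i$ is omitted.
   Context: $\mathcal{H}$ is a complex Hilbert space with inner product $\langle\cdot,\cdot\rangle$, $\mathcal{B}(\mathcal{H})$ is the algebra of bounded linear operators on $\mathcal{H}$, and $A\in\mathcal{B}(\mathcal{H})$ is a fixed positive operator ($\langle Ax,x\rangle\ge 0$ for all $x$). Put $\langle x,y\rangle_A=\langle Ax,y\rangle$ and $\|x\|_A=\sqrt{\langle x,x\rangle_A}$. $\mathcal{B}_A(\mathcal{H})$ is the set of $T\in\mathcal{B}(\mathcal{H})$ admitting an $A$-adjoint, i.e. for which there is $X\in\mathcal{B}(\mathcal{H})$ with $AX=T^*A$ (equivalently $\mathcal{R}(T^*A)\subseteq\mathcal{R}(A)$). The $A$-numerical radius is $w_A(T)=\sup\{|\langle Tx,x\rangle_A|: x\in\mathcal{H},\ \|x\|_A=1\}$. For an $m\times m$ operator matrix acting on $\bigoplus_{i=1}^m\mathcal{H}$ ($m$ copies), $\mathbb{A}$ denotes the $m\times m$ block diagonal operator matrix all of whose diagonal entries are $A$ (the size $m$ being that of the matrix in question), and $w_{\mathbb{A}}$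 is the numerical radius defined in the same way with $\mathcal{H},A$ replaced by $\bigoplus_{i=1}^m\mathcal{H},\mathbb{A}$. $O$ is the zero operator. *)

theory Defs
  imports "HOL-Analysis.Analysis"
begin

(* Complex Hilbert spaces: the underlying real Banach space is the library's class banach; the
   inner product is linear in its first argument and induces the norm. *)
class complex_hilbert = banach +
  fixes scaleC :: "complex \<Rightarrow> 'a \<Rightarrow> 'a" (infixr \<open>*\<^sub>C\<close> 75)
    and cinner :: "'a \<Rightarrow> 'a \<Rightarrow> complex"
  assumes scaleC_add_right: "c *\<^sub>C (x + y) = c *\<^sub>C x + c *\<^sub>C y"
    and scaleC_add_left: "(c + d) *\<^sub>C x = c *\<^sub>C x + d *\<^sub>C x"
    and scaleC_scaleC: "c *\<^sub>C d *\<^sub>C x = (c * d) *\<^sub>C x"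
    and scaleC_of_real: "complex_of_real r *\<^sub>C x = r *\<^sub>R x"
    and cinner_add_left: "cinner (x + y) z = cinner x z + cinner y z"
    and cinner_scaleC_left: "cinner (c *\<^sub>C x) y = c * cinner x y"
    and cinner_commute: "cinner x y = cnj (cinner y x)"
    and cinner_self: "cinner x x = complex_of_real ((norm x)\<^sup>2)"

instantiation complex :: complex_hilbert
begin

definition scaleC_complex :: "complex \<Rightarrow> complex \<Rightarrow> complex"
  where "scaleC_complex c x = c * x"

definition cinner_complex :: "complex \<Rightarrow> complex \<Rightarrow> complex"
  where "cinner_complex x y = x * cnj y"

instance
proof
  fix c d x y z :: complex and r :: real
  show "c *\<^sub>C (x + y) = c *\<^sub>C x + c *\<^sub>C y"
    by (simp add: scaleC_complex_def distrib_left)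
  show "(c + d) *\<^sub>C x = c *\<^sub>C x + d *\<^sub>C x"
    by (simp add: scaleC_complex_def distrib_right)
  show "c *\<^sub>C d *\<^sub>C x = (c * d) *\<^sub>C x"
    by (simp add: scaleC_complex_def)
  show "complex_of_real r *\<^sub>C x = r *\<^sub>R x"
    by (simp add: scaleC_complex_def scaleR_conv_of_real)
  show "cinner (x + y) z = cinner x z + cinner y z"
    by (simp add: cinner_complex_def distrib_right)
  show "cinner (c *\<^sub>C x) y = c * cinner x y"
    by (simp add: cinner_complex_def scaleC_complex_def)
  show "cinner x y = cnj (cinner y x)"
    by (simp add: cinner_complex_def)
  show "cinner x x = complex_of_real ((norm x)\<^sup>2)"
    unfolding cinner_complex_def by (rule complex_norm_square [symmetric])
qed

end

definition bounded_clinear :: "('a::complex_hilbert \<Rightarrow> 'a) \<Rightarrow> bool"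
  where "bounded_clinear T \<longleftrightarrow> bounded_linear T \<and> (\<forall>c x. T (c *\<^sub>C x) = c *\<^sub>C T x)"

definition positive_operator :: "('a::complex_hilbert \<Rightarrow> 'a) \<Rightarrow> bool"
  where "positive_operator A \<longleftrightarrow> bounded_clinear A \<and> (\<forall>x. cinner (A x) x \<in> \<real>\<^sub>\<ge>\<^sub>0)"

(* A Hilbert space adjoint is unique, so this relation says that T' is the adjoint of T. *)
definition is_adjoint :: "('a::complex_hilbert \<Rightarrow> 'a) \<Rightarrow> ('a \<Rightarrow> 'a) \<Rightarrow> bool"
  where "is_adjoint T T' \<longleftrightarrow>
    bounded_clinear T' \<and> (\<forall>x y. cinner (T x) y = cinner x (T' y))"

definition A_adjointable :: "('a::complex_hilbert \<Rightarrow> 'a) \<Rightarrow> ('a \<Rightarrow> 'a) set"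
  where "A_adjointable A = {T. bounded_clinear T \<and>
    (\<exists>X T'. bounded_clinear X \<and> is_adjoint T T' \<and> A \<circ> X = T' \<circ> A)}"

(* The numerical radius of T with respect to the semi-inner product ip (A x) y on the space with
   carrier V and inner product ip. Both the base space (V = UNIV, ip = cinner) and its finite
   direct sums are instances. The supremum is taken in the reals: the set is bounded for
   operators admitting an adjoint with respect to A. It is empty exactly if the seminorm
   vanishes identically on V, and then the value is that of Sup {}. *)
definition numerical_radius_on ::
    "'v set \<Rightarrow> ('v \<Rightarrow> 'v \<Rightarrow> complex) \<Rightarrow> ('v \<Rightarrow> 'v) \<Rightarrow> ('v \<Rightarrow> 'v) \<Rightarrow> real"
  where "numerical_radius_on V ip A T =
    (SUP x \<in> {x \<in> V. sqrt (Re (ip (A x) x)) = 1}. cmod (ip (A (T x)) x))"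

definition A_numerical_radius :: "('a::complex_hilbert \<Rightarrow> 'a) \<Rightarrow> ('a \<Rightarrow> 'a) \<Rightarrow> real"
  where "A_numerical_radius A T = numerical_radius_on UNIV cinner A T"

(* The direct sum of m copies of the space: families with coordinates indexed by 1, ..., m,
   represented by functions that vanish outside {1..m}. *)
definition dsum :: "nat \<Rightarrow> (nat \<Rightarrow> 'a::complex_hilbert) set"
  where "dsum m = {x. \<forall>i. i \<notin> {1..m} \<longrightarrow> x i = 0}"

definition dsum_cinner :: "nat \<Rightarrow> (nat \<Rightarrow> 'a::complex_hilbert) \<Rightarrow> (nat \<Rightarrow> 'a) \<Rightarrow> complex"
  where "dsum_cinner m x y = (\<Sum>i = 1..m. cinner (x i) (y i))"

(* The operator on dsum m given by the m x m operator matrix M, where M i j is the entry in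
   row i and column j. *)
definition matrix_operator ::
    "nat \<Rightarrow> (nat \<Rightarrow> nat \<Rightarrow> 'a::complex_hilbert \<Rightarrow> 'a) \<Rightarrow> (nat \<Rightarrow> 'a) \<Rightarrow> (nat \<Rightarrow> 'a)"
  where "matrix_operator m M x = (\<lambda>i. if i \<in> {1..m} then \<Sum>j = 1..m. M i j (x j) else 0)"

definition diagonal_matrix :: "('a::complex_hilbert \<Rightarrow> 'a) \<Rightarrow> nat \<Rightarrow> nat \<Rightarrow> 'a \<Rightarrow> 'a"
  where "diagonal_matrix A i j = (if i = j then A else (\<lambda>x. 0))"

definition matrix_numerical_radius ::
    "nat \<Rightarrow> ('a::complex_hilbert \<Rightarrow> 'a) \<Rightarrow> (nat \<Rightarrow> nat \<Rightarrow> 'a \<Rightarrow> 'a) \<Rightarrow> real"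
  where "matrix_numerical_radius m A M =
    numerical_radius_on (dsum m) (dsum_cinner m)
      (matrix_operator m (diagonal_matrix A)) (matrix_operator m M)"

(* For odd n the central entry is T ((n + 1) div 2); this is only meaningful if the T and S
   families agree there. *)
definition cross_diagonal ::
    "nat \<Rightarrow> (nat \<Rightarrow> 'a::complex_hilbert \<Rightarrow> 'a) \<Rightarrow> (nat \<Rightarrow> 'a \<Rightarrow> 'a) \<Rightarrow> nat \<Rightarrow> nat \<Rightarrow> 'a \<Rightarrow> 'a"
  where "cross_diagonal n T S i j =
    (if j = i then T i else if j = n + 1 - i then S i else (\<lambda>x. 0))"

(* The 2 x 2 operator matrix with rows (P, Q) and (R, U). *)
definition block2 ::
    "('a::complex_hilbert \<Rightarrow> 'a) \<Rightarrow> ('a \<Rightarrow> 'a) \<Rightarrow> ('a \<Rightarrow> 'a) \<Rightarrow> ('a \<Rightarrow> 'a) \<Rightarrow> nat \<Rightarrow> nat \<Rightarrow> 'a \<Rightarrow> 'a"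
  where "block2 P Q R U i j =
    (if i = 1 then (if j = 1 then P else Q) else (if j = 1 then R else U))"

end

theory Submission
  imports Defs
begin

text \<open>A cross-diagonal operator matrix couples the coordinate \<open>i\<close> only with the coordinate
\<open>n + 1 - i\<close>. It is therefore, up to a permutation of the coordinates, the direct sum of one
\<open>2 \<times> 2\<close> block for each pair \<open>{i, n + 1 - i}\<close> and, for odd \<open>n\<close>, of the central entry. The numerical
radius of a direct sum is the maximum of the numerical radii of its summands, and the index ranges
in the theorem are three ways of listing each pair exactly once.

The proof avoids unitary equivalence and works with quadratic forms. A numerical radius is the
least constant \<open>c\<close> such that the modulus of the form of the operator is at most \<open>c\<close> times the squared
seminorm (\<open>numerical_radius_on_le_iff\<close>). Since both forms of a cross-diagonal matrix split into
sums over the pairs, a number \<open>c\<close> is an upper bound for its numerical radius if and only if it is one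
for the radius of every block (\<open>cross_diagonal_le_iff\<close>); equality with the maximum follows
(\<open>cross_diagonal_numerical_radius_eq_Max\<close>).

Reading a real supremum as a least upper bound requires that it be taken over a nonempty bounded
set. Boundedness is the analytic part: an operator with an \<open>A\<close>-adjoint is bounded for the seminorm
of \<open>A\<close> (\<open>A_adjointable_bounded\<close>), although that seminorm may be much weaker than the norm. The set is
empty only if the seminorm vanishes identically, and in that case all the radii have one common
value.\<close>

section \<open>Inner products and complex linear operators\<close>

lemma cinner_add_right: "cinner x (y + z) = cinner x y + cinner x z"
  by (metis cinner_add_left cinner_commute complex_cnj_add)

lemma cinner_scaleC_right: "cinner x (c *\<^sub>C y) = cnj c * cinner x y"
  by (metis cinner_commute cinner_scaleC_left complex_cnj_mult)

lemma cinner_scaleR_left: "cinner (r *\<^sub>R x) y = of_real r * cinner x y"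
  by (metis cinner_scaleC_left scaleC_of_real)

lemma cinner_scaleR_right: "cinner x (r *\<^sub>R y) = of_real r * cinner x y"
  by (metis cinner_scaleC_right complex_cnj_complex_of_real scaleC_of_real)

lemma cinner_zero_left [simp]: "cinner 0 y = 0"
  using cinner_add_left[of 0 0 y] by simp

lemma cinner_zero_right [simp]: "cinner x 0 = 0"
  using cinner_add_right[of x 0 0] by simp

lemma cinner_sum_left: "cinner (\<Sum>i\<in>I. f i) y = (\<Sum>i\<in>I. cinner (f i) y)"
  by (induction I rule: infinite_finite_induct) (simp_all add: cinner_add_left)

lemma bounded_clinear_simps:
  assumes "bounded_clinear T"
  shows "T (x + y) = T x + T y" "T (r *\<^sub>R x) = r *\<^sub>R T x" "T (c *\<^sub>C x) = c *\<^sub>C T x" "T 0 = 0"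
    "T (\<Sum>i\<in>I. f i) = (\<Sum>i\<in>I. T (f i))"
proof -
  have lin: "linear T" using assms by (simp add: bounded_clinear_def bounded_linear.linear)
  show "T (x + y) = T x + T y" "T (r *\<^sub>R x) = r *\<^sub>R T x" "T 0 = 0"
    using lin by (simp_all add: linear_add linear_scale linear_0)
  show "T (c *\<^sub>C x) = c *\<^sub>C T x" using assms by (simp add: bounded_clinear_def)
  show "T (\<Sum>i\<in>I. f i) = (\<Sum>i\<in>I. T (f i))" using lin by (rule linear_sum)
qed

section \<open>The seminorm of a positive operator\<close>

lemma positive_operatorD:
  assumes "positive_operator A"
  shows "bounded_clinear A" "Re (cinner (A x) x) \<ge> 0" "Im (cinner (A x) x) = 0"
  using assms by (auto simp: positive_operator_def complex_nonneg_Reals_iff)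

text \<open>Positivity forces symmetry because the scalars are complex: polarization with \<open>x + y\<close> and with
\<open>x + \<i> y\<close> gives the imaginary and the real part.\<close>
lemma positive_operator_commute:
  assumes A: "positive_operator A"
  shows "cinner (A y) x = cnj (cinner (A x) y)"
proof -
  note lin = bounded_clinear_simps[OF positive_operatorD(1)[OF A]]
  have "Im (cinner (A x) y + cinner (A y) x) = 0"
    using positive_operatorD(3)[OF A, of "x + y"] positive_operatorD(3)[OF A, of x]
      positive_operatorD(3)[OF A, of y]
    by (simp add: lin cinner_add_left cinner_add_right)
  moreover have "Re (cinner (A y) x - cinner (A x) y) = 0"
    using positive_operatorD(3)[OF A, of "x + \<i> *\<^sub>C y"] positive_operatorD(3)[OF A, of x]
      positive_operatorD(3)[OF A, of y]
    by (simp add: lin cinner_add_left cinner_add_right cinner_scaleC_left cinner_scaleC_right)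
  ultimately show ?thesis by (simp add: complex_eq_iff)
qed

lemma cinner_positive_operator_right:
  assumes "positive_operator A"
  shows "cinner x (A y) = cinner (A x) y"
  by (metis assms cinner_commute positive_operator_commute)

definition seminorm_of :: "('a::complex_hilbert \<Rightarrow> 'a) \<Rightarrow> 'a \<Rightarrow> real"
  where "seminorm_of A x = sqrt (Re (cinner (A x) x))"

lemma seminorm_of_nonneg: "positive_operator A \<Longrightarrow> seminorm_of A x \<ge> 0"
  by (simp add: seminorm_of_def positive_operatorD)

lemma seminorm_of_square: "positive_operator A \<Longrightarrow> (seminorm_of A x)\<^sup>2 = Re (cinner (A x) x)"
  by (simp add: seminorm_of_def positive_operatorD)

text \<open>The Cauchy--Schwarz inequality for the semi-inner product \<open>cinner (A x) y\<close>. The form may be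
degenerate, so the usual minimization over \<open>x + c y\<close> needs a separate argument when \<open>y\<close> has
seminorm zero.\<close>
lemma cmod_cinner_le_seminorm_of:
  assumes A: "positive_operator A"
  shows "cmod (cinner (A x) y) \<le> seminorm_of A x * seminorm_of A y"
proof -
  note lin = bounded_clinear_simps[OF positive_operatorD(1)[OF A]]
  define z where "z = cinner (A x) y"
  define a where "a = Re (cinner (A x) x)"
  define b where "b = Re (cinner (A y) y)"
  have b0: "b \<ge> 0" and a0: "a \<ge> 0" unfolding a_def b_def using positive_operatorD[OF A] by auto
  \<comment> \<open>The choice \<open>c = - t z\<close> turns the cross terms into a real multiple of \<open>(cmod z)\<^sup>2\<close>.\<close>
  have ineq: "0 \<le> a - 2 * t * (cmod z)\<^sup>2 + t\<^sup>2 * (cmod z)\<^sup>2 * b" for t :: real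
  proof -
    define c where "c = - (of_real t * z)"
    have bb: "cinner (A y) y = of_real b"
      using positive_operatorD(3)[OF A, of y] by (simp add: b_def complex_eq_iff)
    have "0 \<le> Re (cinner (A (x + c *\<^sub>C y)) (x + c *\<^sub>C y))"
      using positive_operatorD[OF A] by blast
    also have "cinner (A (x + c *\<^sub>C y)) (x + c *\<^sub>C y)
       = cinner (A x) x + cnj c * z + c * cnj z + c * cnj c * of_real b"
      by (simp add: lin cinner_add_left cinner_add_right cinner_scaleC_left cinner_scaleC_right
         z_def bb positive_operator_commute[OF A, of y x] algebra_simps)
    also have "\<dots> = cinner (A x) x + of_real (- 2 * t * (cmod z)\<^sup>2 + t\<^sup>2 * (cmod z)\<^sup>2 * b)"
    proof -
      have "complex_of_real (- 2 * t * (cmod z)\<^sup>2 + t\<^sup>2 * (cmod z)\<^sup>2 * b)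
          = - 2 * of_real t * (z * cnj z) + (of_real t)\<^sup>2 * (z * cnj z) * of_real b"
        unfolding complex_norm_square[symmetric] by simp
      then show ?thesis by (simp add: c_def algebra_simps power2_eq_square)
    qed
    finally show ?thesis by (simp add: a_def)
  qed
  have "(cmod z)\<^sup>2 \<le> a * b"
  \<comment> \<open>If \<open>b = 0\<close>, the lower bound is affine in \<open>t\<close>, and at the \<open>t\<close> chosen below it is negative
    unless \<open>z = 0\<close>. If \<open>b > 0\<close>, the bound is sharpest at \<open>t = 1 / b\<close>.\<close>
  proof (cases "b = 0")
    case True
    have "(cmod z)\<^sup>2 = 0"
    proof (rule ccontr)
      assume nz: "(cmod z)\<^sup>2 \<noteq> 0"
      have "0 \<le> a - 2 * ((a + 1) / (cmod z)\<^sup>2) * (cmod z)\<^sup>2"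
        using ineq[of "(a + 1) / (cmod z)\<^sup>2"] True by simp
      then show False using nz a0 by simp
    qed
    then show ?thesis using True by simp
  next
    case False
    then have "b > 0" using b0 by simp
    then show ?thesis using ineq[of "1 / b"] by (simp add: field_simps power2_eq_square)
  qed
  then have "cmod z \<le> sqrt (a * b)" by (rule real_le_rsqrt)
  then show ?thesis by (simp add: z_def a_def b_def seminorm_of_def real_sqrt_mult)
qed

text \<open>The case of the identity operator, whose seminorm is the norm.\<close>
lemma cinner_Cauchy_Schwarz: "cmod (cinner x y) \<le> norm x * norm (y::'a::complex_hilbert)"
proof -
  have "positive_operator (\<lambda>x::'a. x)"
    by (auto simp: positive_operator_def bounded_clinear_def cinner_self complex_nonneg_Reals_iff
        bounded_linear_ident)
  from cmod_cinner_le_seminorm_of[OF this, of x y] show ?thesis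
    by (simp add: seminorm_of_def cinner_self del: of_real_power)
qed

lemma seminorm_of_le_norm:
  assumes A: "positive_operator A"
  shows "seminorm_of A x \<le> sqrt (onorm A) * norm x"
proof -
  have bl: "bounded_linear A" using positive_operatorD(1)[OF A] by (simp add: bounded_clinear_def)
  have "Re (cinner (A x) x) \<le> norm (A x) * norm x"
    using cinner_Cauchy_Schwarz[of "A x" x] complex_Re_le_cmod order_trans by blast
  also have "\<dots> \<le> onorm A * norm x * norm x"
    by (intro mult_right_mono onorm[OF bl]) simp
  finally have "seminorm_of A x \<le> sqrt (onorm A * (norm x)\<^sup>2)"
    by (simp add: seminorm_of_def power2_eq_square mult.assoc)
  then show ?thesis by (simp add: real_sqrt_mult)
qed

section \<open>Operators with an adjoint are bounded for the seminorm\<close>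

text \<open>The difficulty is that continuity of \<open>P\<close> refers to the norm, which the seminorm does not control.
By symmetry and Cauchy--Schwarz the sequence \<open>a m\<close> of seminorms of \<open>(P ^^ m) x\<close> is
logarithmically convex, so it grows at least like the powers of its first quotient
\<open>r = a 1 / a 0\<close>. On the other hand the seminorm is dominated by a multiple of the norm, so
\<open>a m\<close> grows at most like the powers of \<open>onorm P\<close>. Hence \<open>r \<le> onorm P\<close>. If \<open>a 0 = 0\<close>,
convexity gives \<open>a 1 = 0\<close>.\<close>
lemma seminorm_of_symmetric_operator_le:
  fixes P :: "'a::complex_hilbert \<Rightarrow> 'a"
  assumes A: "positive_operator A" and P: "bounded_linear P"
    and sym: "\<And>x y. cinner (A (P x)) y = cinner (A x) (P y)"
  shows "seminorm_of A (P x) \<le> onorm P * seminorm_of A x"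
proof (rule ccontr)
  assume neg: "\<not> ?thesis"
  define K where "K = onorm P"
  define a where "a m = seminorm_of A ((P ^^ m) x)" for m
  have K0: "K \<ge> 0" unfolding K_def using P by (rule onorm_pos_le)
  have a_nonneg: "a m \<ge> 0" for m unfolding a_def using A by (rule seminorm_of_nonneg)
  have gt: "a 1 > K * a 0" using neg by (simp add: a_def K_def)
  have convex: "(a (Suc m))\<^sup>2 \<le> a m * a (Suc (Suc m))" for m
  proof -
    have "(a (Suc m))\<^sup>2 = Re (cinner (A ((P ^^ m) x)) (P ((P ^^ Suc m) x)))"
      unfolding a_def seminorm_of_square[OF A] by (simp add: sym)
    also have "\<dots> \<le> a m * a (Suc (Suc m))"
      using cmod_cinner_le_seminorm_of[OF A, of "(P ^^ m) x" "P ((P ^^ Suc m) x)"]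
        complex_Re_le_cmod order_trans unfolding a_def by fastforce
    finally show ?thesis .
  qed
  have a1: "a 1 > 0" using gt K0 a_nonneg[of 0] by (smt (verit) mult_nonneg_nonneg)
  have a0: "a 0 > 0" using convex[of 0] a1 a_nonneg[of 0]
    by (cases "a 0 = 0") auto
  define r where "r = a 1 / a 0"
  have r: "r > K" "r > 0" using gt a0 a1 by (simp_all add: r_def field_simps)
  have growth: "r * a m \<le> a (Suc m) \<and> a m > 0" for m
  proof (induction m)
    case 0
    then show ?case using a0 by (simp add: r_def)
  next
    case (Suc m)
    then have pos: "a (Suc m) > 0" and am: "a m > 0"
      using r by (auto intro: less_le_trans[OF mult_pos_pos])
    have "r * a m * a (Suc m) \<le> a (Suc m) * a (Suc m)"
      using Suc pos by (intro mult_right_mono) auto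
    also have "\<dots> \<le> a m * a (Suc (Suc m))" using convex[of m] by (simp add: power2_eq_square)
    finally have "a m * (r * a (Suc m)) \<le> a m * a (Suc (Suc m))" by (simp add: mult_ac)
    then show ?case using am pos by simp
  qed
  have lower: "r ^ m * a 0 \<le> a m" for m
  proof (induction m)
    case (Suc m)
    have "r ^ Suc m * a 0 \<le> r * a m" using Suc r by (simp add: mult.assoc)
    then show ?case using growth[of m] by linarith
  qed simp
  have norm_power: "norm ((P ^^ m) x) \<le> K ^ m * norm x" for m
  proof (induction m)
    case (Suc m)
    have "norm ((P ^^ Suc m) x) \<le> K * norm ((P ^^ m) x)"
      unfolding K_def using onorm[OF P] by simp
    also have "\<dots> \<le> K * (K ^ m * norm x)" using Suc K0 by (rule mult_left_mono)
    finally show ?case by (simp add: mult.assoc)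
  qed simp
  define D where "D = sqrt (onorm A) * norm x"
  have upper: "a m \<le> D * K ^ m" for m
  proof -
    have oA: "onorm A \<ge> 0"
      using positive_operatorD(1)[OF A] by (intro onorm_pos_le) (simp add: bounded_clinear_def)
    have "a m \<le> sqrt (onorm A) * norm ((P ^^ m) x)"
      unfolding a_def by (rule seminorm_of_le_norm[OF A])
    also have "\<dots> \<le> sqrt (onorm A) * (K ^ m * norm x)"
      using norm_power oA by (intro mult_left_mono) auto
    finally show ?thesis by (simp add: D_def mult_ac)
  qed
  have "K > 0"
  proof (rule ccontr)
    assume "\<not> K > 0"
    then have "a 1 \<le> 0" using upper[of 1] K0 by simp
    then show False using a1 by simp
  qed
  then have "(r / K) ^ m \<le> D / a 0" for m
    using lower[of m] upper[of m] a0 by (simp add: field_simps power_divide)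
  moreover obtain m where "(r / K) ^ m > D / a 0"
    using real_arch_pow[of "r / K" "D / a 0"] r \<open>K > 0\<close> by auto
  ultimately show False by (meson not_less)
qed

text \<open>If \<open>X\<close> is an \<open>A\<close>-adjoint of \<open>T\<close>, then \<open>P = X \<circ> T\<close> is symmetric for the semi-inner product, and
the squared seminorm of \<open>T x\<close> is the semi-inner product of \<open>x\<close> and \<open>P x\<close>. Thus the bound for the
symmetric operator \<open>P\<close> yields one for \<open>T\<close>. This is what makes the suprema that define the
numerical radii finite.\<close>
lemma A_adjointable_bounded:
  assumes A: "positive_operator A" and T: "T \<in> A_adjointable A"
  obtains C where "C \<ge> 0" "\<And>x y. cmod (cinner (A (T x)) y) \<le> C * (seminorm_of A x * seminorm_of A y)"
proof -
  from T obtain X T' where Tl: "bounded_clinear T" and Xl: "bounded_clinear X"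
    and adj: "\<And>x y. cinner (T x) y = cinner x (T' y)" and AX: "\<And>x. A (X x) = T' (A x)"
    by (auto simp: A_adjointable_def is_adjoint_def fun_eq_iff)
  have swap: "cinner (A (T x)) y = cinner (A x) (X y)" for x y
    by (metis A AX adj cinner_positive_operator_right)
  have swap': "cinner (A (X x)) y = cinner (A x) (T y)" for x y
    by (metis A swap positive_operator_commute)
  define K where "K = onorm (\<lambda>x. X (T x))"
  have P: "bounded_linear (\<lambda>x. X (T x))"
    using Tl Xl by (simp add: bounded_clinear_def bounded_linear_compose)
  have "K \<ge> 0" unfolding K_def using P by (rule onorm_pos_le)
  have P_le: "seminorm_of A (X (T x)) \<le> K * seminorm_of A x" for x
    unfolding K_def
    by (rule seminorm_of_symmetric_operator_le[OF A P]) (simp add: swap swap')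
  have T_le: "seminorm_of A (T x) \<le> sqrt K * seminorm_of A x" for x
  proof (rule power2_le_imp_le)
    have "(seminorm_of A (T x))\<^sup>2 = Re (cinner (A x) (X (T x)))"
      by (simp add: seminorm_of_square[OF A] swap)
    also have "\<dots> \<le> seminorm_of A x * seminorm_of A (X (T x))"
      using cmod_cinner_le_seminorm_of[OF A, of x "X (T x)"] complex_Re_le_cmod order_trans by blast
    also have "\<dots> \<le> seminorm_of A x * (K * seminorm_of A x)"
      using P_le seminorm_of_nonneg[OF A] by (intro mult_left_mono)
    also have "\<dots> = (sqrt K * seminorm_of A x)\<^sup>2"
      using \<open>K \<ge> 0\<close> by (simp add: power_mult_distrib power2_eq_square)
    finally show "(seminorm_of A (T x))\<^sup>2 \<le> (sqrt K * seminorm_of A x)\<^sup>2" .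
    show "0 \<le> sqrt K * seminorm_of A x" using \<open>K \<ge> 0\<close> seminorm_of_nonneg[OF A] by simp
  qed
  show thesis
  proof (rule that[of "sqrt K"])
    show "sqrt K \<ge> 0" using \<open>K \<ge> 0\<close> by simp
    fix x y
    have "cmod (cinner (A (T x)) y) \<le> seminorm_of A (T x) * seminorm_of A y"
      by (rule cmod_cinner_le_seminorm_of[OF A])
    also have "\<dots> \<le> sqrt K * seminorm_of A x * seminorm_of A y"
      using T_le seminorm_of_nonneg[OF A] by (intro mult_right_mono)
    finally show "cmod (cinner (A (T x)) y) \<le> sqrt K * (seminorm_of A x * seminorm_of A y)"
      by (simp add: mult.assoc)
  qed
qed

lemma A_adjointable_bounded_clinear: "T \<in> A_adjointable A \<Longrightarrow> bounded_clinear T"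
  by (simp add: A_adjointable_def)

text \<open>This covers the entries of a cross-diagonal matrix off its two diagonals.\<close>
lemma zero_A_adjointable:
  assumes "positive_operator A"
  shows "(\<lambda>x. 0) \<in> A_adjointable A"
proof -
  have "bounded_clinear (\<lambda>x::'a. 0)"
    unfolding bounded_clinear_def
    by (metis bounded_linear_zero cinner_self cinner_scaleC_left cinner_zero_right mult_zero_right
      of_real_eq_0_iff power2_eq_square mult_eq_0_iff norm_eq_zero)
  then show ?thesis
    using positive_operatorD(1)[OF assms]
    by (auto simp: A_adjointable_def is_adjoint_def fun_eq_iff bounded_clinear_simps
      intro!: exI[of _ "\<lambda>x::'a. 0"])
qed

section \<open>Numerical radii as optimal constants\<close>

text \<open>Rescaling to seminorm one replaces the supremum by an inequality between two forms that are
quadratic on all of \<open>V\<close>, and such inequalities can be restricted to subspaces and added. The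
hypotheses ensure that the supremum is one of a nonempty bounded set of reals: \<open>bound\<close> gives
boundedness and also settles vectors of seminorm zero, and \<open>z\<close> gives nonemptiness. Scalar
multiplication is passed as \<open>s\<close> because the families that make up a direct sum form a bare
function type without a vector space structure.\<close>
lemma numerical_radius_on_le_iff:
  fixes s :: "real \<Rightarrow> 'v \<Rightarrow> 'v"
  assumes V: "\<And>r x. x \<in> V \<Longrightarrow> s r x \<in> V"
    and scale: "\<And>r x. x \<in> V \<Longrightarrow> ip (A (s r x)) (s r x) = of_real (r\<^sup>2) * ip (A x) x"
      "\<And>r x. x \<in> V \<Longrightarrow> ip (A (T (s r x))) (s r x) = of_real (r\<^sup>2) * ip (A (T x)) x"
    and pos: "\<And>x. x \<in> V \<Longrightarrow> Re (ip (A x) x) \<ge> 0"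
    and bound: "\<And>x. x \<in> V \<Longrightarrow> cmod (ip (A (T x)) x) \<le> C * Re (ip (A x) x)"
    and z: "z \<in> V" "Re (ip (A z) z) > 0"
  shows "numerical_radius_on V ip A T \<le> c \<longleftrightarrow>
    (\<forall>x\<in>V. cmod (ip (A (T x)) x) \<le> c * Re (ip (A x) x))"
proof -
  define U where "U = {x \<in> V. sqrt (Re (ip (A x) x)) = 1}"
  have normalize: "s (1 / sqrt (Re (ip (A x) x))) x \<in> U" if "x \<in> V" "Re (ip (A x) x) > 0" for x
    using that by (simp add: U_def V scale(1) power_divide)
  have bdd: "bdd_above ((\<lambda>x. cmod (ip (A (T x)) x)) ` U)"
    by (rule bdd_aboveI2[of _ _ C]) (use bound in \<open>force simp: U_def\<close>)
  have "numerical_radius_on V ip A T \<le> c \<longleftrightarrow> (\<forall>x\<in>U. cmod (ip (A (T x)) x) \<le> c)"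
    unfolding numerical_radius_on_def U_def[symmetric]
    using normalize[OF z] by (intro cSUP_le_iff bdd) auto
  also have "\<dots> \<longleftrightarrow> (\<forall>x\<in>V. cmod (ip (A (T x)) x) \<le> c * Re (ip (A x) x))"
  proof (intro iffI ballI)
    fix x assume unit: "\<forall>x\<in>U. cmod (ip (A (T x)) x) \<le> c" and x: "x \<in> V"
    show "cmod (ip (A (T x)) x) \<le> c * Re (ip (A x) x)"
    proof (cases "Re (ip (A x) x) = 0")
      case True
      then show ?thesis using bound[OF x] by simp
    next
      case False
      then have p: "Re (ip (A x) x) > 0" using pos[OF x] by simp
      have "cmod (of_real ((1 / sqrt (Re (ip (A x) x)))\<^sup>2) * ip (A (T x)) x) \<le> c"
        using unit normalize[OF x p] scale(2)[OF x] by metis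
      then show ?thesis using p by (simp add: norm_mult norm_divide power_divide field_simps)
    qed
  next
    fix x assume "\<forall>x\<in>V. cmod (ip (A (T x)) x) \<le> c * Re (ip (A x) x)" and "x \<in> U"
    then show "cmod (ip (A (T x)) x) \<le> c" by (force simp: U_def)
  qed
  finally show ?thesis .
qed

lemma A_numerical_radius_le_iff:
  assumes A: "positive_operator A" and T: "T \<in> A_adjointable A" and z: "Re (cinner (A z) z) > 0"
  shows "A_numerical_radius A T \<le> c \<longleftrightarrow>
    (\<forall>x. cmod (cinner (A (T x)) x) \<le> c * Re (cinner (A x) x))"
proof -
  note lin = bounded_clinear_simps[OF positive_operatorD(1)[OF A]]
    bounded_clinear_simps[OF A_adjointable_bounded_clinear[OF T]]
  obtain C where C: "C \<ge> 0"
    "\<And>x y. cmod (cinner (A (T x)) y) \<le> C * (seminorm_of A x * seminorm_of A y)"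
    using A_adjointable_bounded[OF A T] by metis
  have "A_numerical_radius A T \<le> c \<longleftrightarrow>
    (\<forall>x\<in>UNIV. cmod (cinner (A (T x)) x) \<le> c * Re (cinner (A x) x))"
    unfolding A_numerical_radius_def
  proof (rule numerical_radius_on_le_iff[where s = scaleR and z = z and C = C])
    show "cmod (cinner (A (T x)) x) \<le> C * Re (cinner (A x) x)" for x
      using C(2)[of x x] seminorm_of_square[OF A, of x] by (simp add: power2_eq_square)
  qed (simp_all add: z lin cinner_scaleR_left cinner_scaleR_right power2_eq_square
      positive_operatorD[OF A])
  then show ?thesis by simp
qed

lemma dsum_cinner_diagonal:
  "dsum_cinner m (matrix_operator m (diagonal_matrix A) x) y = (\<Sum>i = 1..m. cinner (A (x i)) (y i))"
  unfolding dsum_cinner_def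
proof (rule sum.cong[OF refl])
  fix i assume i: "i \<in> {1..m}"
  have "(\<Sum>j = 1..m. diagonal_matrix A i j (x j)) = (\<Sum>j = 1..m. if i = j then A (x j) else 0)"
    by (intro sum.cong) (auto simp: diagonal_matrix_def)
  then show "cinner (matrix_operator m (diagonal_matrix A) x i) (y i) = cinner (A (x i)) (y i)"
    using i by (simp add: matrix_operator_def)
qed

lemma dsum_cinner_diagonal_matrix_operator:
  assumes "positive_operator A"
  shows "dsum_cinner m (matrix_operator m (diagonal_matrix A) (matrix_operator m M x)) y =
    (\<Sum>i = 1..m. \<Sum>j = 1..m. cinner (A (M i j (x j))) (y i))"
  unfolding dsum_cinner_diagonal
  by (intro sum.cong refl)
    (simp add: matrix_operator_def bounded_clinear_simps[OF positive_operatorD(1)[OF assms]]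
      cinner_sum_left)

text \<open>Each entry is bounded for the seminorm, and the seminorm of a coordinate is at most that of the
whole family. So the sum of the entrywise constants bounds the quadratic form of the matrix.\<close>
lemma matrix_numerical_radius_le_iff:
  assumes A: "positive_operator A" and m: "m \<ge> 1"
    and M: "\<And>i j. i \<in> {1..m} \<Longrightarrow> j \<in> {1..m} \<Longrightarrow> M i j \<in> A_adjointable A"
    and z: "Re (cinner (A z) z) > 0"
  shows "matrix_numerical_radius m A M \<le> c \<longleftrightarrow>
    (\<forall>x\<in>dsum m. cmod (\<Sum>i = 1..m. \<Sum>j = 1..m. cinner (A (M i j (x j))) (x i))
      \<le> c * (\<Sum>i = 1..m. Re (cinner (A (x i)) (x i))))"
proof -
  note lin = bounded_clinear_simps[OF positive_operatorD(1)[OF A]]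
  have "\<exists>C\<ge>0. \<forall>x y. cmod (cinner (A (M i j x)) y) \<le> C * (seminorm_of A x * seminorm_of A y)"
    if "i \<in> {1..m}" "j \<in> {1..m}" for i j
    using A_adjointable_bounded[OF A M[OF that]] by metis
  then obtain C where C0: "\<And>i j. i \<in> {1..m} \<Longrightarrow> j \<in> {1..m} \<Longrightarrow> C i j \<ge> 0"
    and C: "\<And>i j x y. i \<in> {1..m} \<Longrightarrow> j \<in> {1..m} \<Longrightarrow>
      cmod (cinner (A (M i j x)) y) \<le> C i j * (seminorm_of A x * seminorm_of A y)"
    by metis
  have "matrix_numerical_radius m A M \<le> c \<longleftrightarrow>
    (\<forall>x\<in>dsum m. cmod (dsum_cinner m (matrix_operator m (diagonal_matrix A) (matrix_operator m M x)) x)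
      \<le> c * Re (dsum_cinner m (matrix_operator m (diagonal_matrix A) x) x))"
    unfolding matrix_numerical_radius_def
  proof (rule numerical_radius_on_le_iff[where s = "\<lambda>r x i. r *\<^sub>R x i"
        and z = "(\<lambda>_. 0)(1 := z)" and C = "\<Sum>i = 1..m. \<Sum>j = 1..m. C i j"])
    fix x :: "nat \<Rightarrow> 'a" and r :: real
    let ?N = "\<Sum>i = 1..m. Re (cinner (A (x i)) (x i))"
    show "x \<in> dsum m \<Longrightarrow> (\<lambda>i. r *\<^sub>R x i) \<in> dsum m" by (simp add: dsum_def)
    show "dsum_cinner m (matrix_operator m (diagonal_matrix A) (\<lambda>i. r *\<^sub>R x i)) (\<lambda>i. r *\<^sub>R x i)
      = of_real (r\<^sup>2) * dsum_cinner m (matrix_operator m (diagonal_matrix A) x) x"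
      by (simp add: dsum_cinner_diagonal lin cinner_scaleR_left cinner_scaleR_right
          sum_distrib_left power2_eq_square mult_ac)
    show "dsum_cinner m (matrix_operator m (diagonal_matrix A)
          (matrix_operator m M (\<lambda>i. r *\<^sub>R x i))) (\<lambda>i. r *\<^sub>R x i)
      = of_real (r\<^sup>2) * dsum_cinner m (matrix_operator m (diagonal_matrix A) (matrix_operator m M x)) x"
      unfolding dsum_cinner_diagonal_matrix_operator[OF A] sum_distrib_left
    proof (intro sum.cong refl)
      fix i j assume "i \<in> {1..m}" "j \<in> {1..m}"
      then show "cinner (A (M i j (r *\<^sub>R x j))) (r *\<^sub>R x i)
          = of_real (r\<^sup>2) * cinner (A (M i j (x j))) (x i)"
        using bounded_clinear_simps(2)[OF A_adjointable_bounded_clinear[OF M]]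
        by (simp add: lin cinner_scaleR_left cinner_scaleR_right power2_eq_square)
    qed
    have N0: "?N \<ge> 0" by (intro sum_nonneg) (simp add: positive_operatorD[OF A])
    then show "Re (dsum_cinner m (matrix_operator m (diagonal_matrix A) x) x) \<ge> 0"
      by (simp add: dsum_cinner_diagonal)
    have le: "seminorm_of A (x i) \<le> sqrt ?N" if "i \<in> {1..m}" for i
      unfolding seminorm_of_def real_sqrt_le_iff
      using that by (intro member_le_sum) (auto simp: positive_operatorD[OF A])
    have "cmod (\<Sum>i = 1..m. \<Sum>j = 1..m. cinner (A (M i j (x j))) (x i))
        \<le> (\<Sum>i = 1..m. \<Sum>j = 1..m. C i j * ?N)"
    proof (intro sum_norm_le)
      fix i j assume ij: "i \<in> {1..m}" "j \<in> {1..m}"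
      have "cmod (cinner (A (M i j (x j))) (x i)) \<le> C i j * (seminorm_of A (x j) * seminorm_of A (x i))"
        by (rule C[OF ij])
      also have "\<dots> \<le> C i j * (sqrt ?N * sqrt ?N)"
        using ij le C0 N0 seminorm_of_nonneg[OF A] by (intro mult_left_mono mult_mono) auto
      finally show "cmod (cinner (A (M i j (x j))) (x i)) \<le> C i j * ?N" using N0 by simp
    qed
    then show "cmod (dsum_cinner m (matrix_operator m (diagonal_matrix A) (matrix_operator m M x)) x)
      \<le> (\<Sum>i = 1..m. \<Sum>j = 1..m. C i j) * Re (dsum_cinner m (matrix_operator m (diagonal_matrix A) x) x)"
      by (simp only: dsum_cinner_diagonal_matrix_operator[OF A])
        (simp add: dsum_cinner_diagonal sum_distrib_right)
  next
    show "(\<lambda>_. 0)(1 := z) \<in> dsum m" using m by (simp add: dsum_def)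
    have "(\<Sum>i = 1..m. cinner (A (((\<lambda>_. 0)(1 := z)) i)) (((\<lambda>_. 0)(1 := z)) i))
        = (\<Sum>i = 1..m. if i = 1 then cinner (A z) z else 0)"
      by (intro sum.cong) auto
    then show "Re (dsum_cinner m (matrix_operator m (diagonal_matrix A) ((\<lambda>_. 0)(1 := z)))
        ((\<lambda>_. 0)(1 := z))) > 0"
      using m z by (simp add: dsum_cinner_diagonal)
  qed
  then show ?thesis
    by (simp only: dsum_cinner_diagonal_matrix_operator[OF A])
      (simp add: dsum_cinner_diagonal)
qed

text \<open>If the seminorm vanishes identically, no vector has seminorm one, and every numerical radius takes
the same unspecified value.\<close>
lemma A_numerical_radius_degenerate:
  assumes "\<And>x. Re (cinner (A x) x) = 0"
  shows "A_numerical_radius A T = Sup {}"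
  by (simp add: A_numerical_radius_def numerical_radius_on_def assms)

lemma matrix_numerical_radius_degenerate:
  assumes "\<And>x. Re (cinner (A x) x) = 0"
  shows "matrix_numerical_radius m A M = Sup {}"
  by (simp add: matrix_numerical_radius_def numerical_radius_on_def dsum_cinner_diagonal assms)

section \<open>Cross-diagonal matrices\<close>

text \<open>Here \<open>J\<close> contains exactly one point of each two-element orbit of the reflection
\<open>i \<mapsto> n + 1 - i\<close> of \<open>{1..n}\<close>. The only other orbit is the fixed point \<open>(n + 1) div 2\<close>, which
exists for odd \<open>n\<close>.\<close>
lemma sum_reflection_representatives:
  fixes f :: "nat \<Rightarrow> 'b::comm_monoid_add"
  assumes J: "J \<subseteq> {1..n}" "\<And>j. j \<in> J \<Longrightarrow> 2 * j \<noteq> n + 1"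
    and exact: "\<And>i. i \<in> {1..n} \<Longrightarrow> 2 * i \<noteq> n + 1 \<Longrightarrow> i \<in> J \<longleftrightarrow> n + 1 - i \<notin> J"
  shows "(\<Sum>i = 1..n. f i) =
    (\<Sum>j\<in>J. f (n + 1 - j) + f j) + (if odd n then f ((n + 1) div 2) else 0)"
proof -
  let ?r = "\<lambda>j. n + 1 - j" and ?C = "{i \<in> {1..n}. 2 * i = n + 1}"
  have fin: "finite J" using J(1) finite_subset by blast
  have "{1..n} = (?r ` J \<union> J) \<union> ?C"
  proof (intro equalityI subsetI)
    fix i assume i: "i \<in> {1..n}"
    then have "i \<in> J \<or> n + 1 - i \<in> J \<or> 2 * i = n + 1" using exact by blast
    moreover have "i = n + 1 - (n + 1 - i)" using i by auto
    ultimately show "i \<in> (?r ` J \<union> J) \<union> ?C" using i by blast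
  qed (use J(1) in force)
  then have "(\<Sum>i = 1..n. f i) = sum f ((?r ` J \<union> J) \<union> ?C)" by (rule arg_cong)
  also have "\<dots> = sum f (?r ` J) + sum f J + sum f ?C"
  proof -
    have inv: "n + 1 - (n + 1 - j) = j \<and> n + 1 - j \<in> {1..n}" if "j \<in> J" for j
    proof -
      have "1 \<le> j" "j \<le> n" using that J(1) by auto
      then show ?thesis by auto
    qed
    have "?r ` J \<inter> J = {}" using exact J by blast
    moreover have "(?r ` J \<union> J) \<inter> ?C = {}" using J by force
    ultimately show ?thesis using fin by (simp add: sum.union_disjoint)
  qed
  also have "sum f (?r ` J) = (\<Sum>j\<in>J. f (n + 1 - j))"
  proof -
    have "inj_on ?r J" by (rule inj_onI) (use J(1) in force)
    then show ?thesis by (simp add: sum.reindex)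
  qed
  also have "sum f ?C = (if odd n then f ((n + 1) div 2) else 0)"
  proof (cases "odd n")
    case True
    then have "?C = {(n + 1) div 2}" by (auto elim!: oddE)
    then show ?thesis using True by simp
  next
    case False
    then have "?C = {}" by auto presburger
    then show ?thesis using False by (metis (no_types, lifting) sum.empty)
  qed
  finally show ?thesis by (simp add: sum.distrib)
qed

text \<open>The definition of a cross-diagonal matrix gives precedence to the diagonal, so a central row has
the single entry \<open>T i\<close>.\<close>
lemma cross_diagonal_row_form:
  assumes A: "positive_operator A" and i: "i \<in> {1..n}"
  shows "(\<Sum>j = 1..n. cinner (A (cross_diagonal n T S i j (x j))) y) =
    cinner (A (T i (x i))) y + (if 2 * i = n + 1 then 0 else cinner (A (S i (x (n + 1 - i)))) y)"
proof -
  note A0 = bounded_clinear_simps(4)[OF positive_operatorD(1)[OF A]]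
  have reflected: "n + 1 - i \<in> {1..n}" using i by auto
  have "(\<Sum>j = 1..n. cinner (A (cross_diagonal n T S i j (x j))) y) =
    (\<Sum>j = 1..n. (if j = i then cinner (A (T i (x i))) y else 0)
      + (if j = n + 1 - i then if 2 * i = n + 1 then 0 else cinner (A (S i (x (n + 1 - i)))) y else 0))"
    using i by (intro sum.cong) (auto simp: cross_diagonal_def A0)
  also have "\<dots> = cinner (A (T i (x i))) y
      + (if 2 * i = n + 1 then 0 else cinner (A (S i (x (n + 1 - i)))) y)"
    using i reflected by (simp add: sum.distrib)
  finally show ?thesis .
qed

text \<open>The coordinates \<open>n + 1 - j\<close> and \<open>j\<close> interact only with each other, so both the quadratic form and
the squared seminorm are sums over the orbits of the reflection. An inequality for the whole sum
restricts to families supported on a single orbit, and the inequalities for the orbits add up to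
one for the sum.\<close>
lemma cross_diagonal_le_iff:
  fixes T S :: "nat \<Rightarrow> 'a::complex_hilbert \<Rightarrow> 'a"
  assumes A: "positive_operator A" and n: "n \<ge> 1"
    and T: "\<And>i. i \<in> {1..n} \<Longrightarrow> T i \<in> A_adjointable A"
    and S: "\<And>i. i \<in> {1..n} \<Longrightarrow> S i \<in> A_adjointable A"
    and J: "J \<subseteq> {1..n}" "\<And>j. j \<in> J \<Longrightarrow> 2 * j \<noteq> n + 1"
    and exact: "\<And>i. i \<in> {1..n} \<Longrightarrow> 2 * i \<noteq> n + 1 \<Longrightarrow> i \<in> J \<longleftrightarrow> n + 1 - i \<notin> J"
    and z: "Re (cinner (A z) z) > 0"
  defines "B \<equiv> \<lambda>j. block2 (T (n + 1 - j)) (S (n + 1 - j)) (S j) (T j)"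
    and "m \<equiv> (n + 1) div 2"
  shows "matrix_numerical_radius n A (cross_diagonal n T S) \<le> c \<longleftrightarrow>
    (\<forall>j\<in>J. matrix_numerical_radius 2 A (B j) \<le> c) \<and> (odd n \<longrightarrow> A_numerical_radius A (T m) \<le> c)"
proof -
  note A0 = bounded_clinear_simps(4)[OF positive_operatorD(1)[OF A]]
  have T0: "T i 0 = 0" and S0: "S i 0 = 0" if "i \<in> {1..n}" for i
    using bounded_clinear_simps(4) A_adjointable_bounded_clinear T[OF that] S[OF that] by blast+
  define N where "N x = Re (cinner (A x) x)" for x
  \<comment> \<open>The form of the block belonging to \<open>j\<close>; \<open>u\<close> sits at the coordinate \<open>n + 1 - j\<close> and \<open>v\<close> at \<open>j\<close>.\<close>
  define q where "q j u v =
    cinner (A (T (n + 1 - j) u)) u + cinner (A (S (n + 1 - j) v)) u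
    + (cinner (A (S j u)) v + cinner (A (T j v)) v)" for j u v
  have refl_J: "n + 1 - j \<in> {1..n}" "2 * (n + 1 - j) \<noteq> n + 1" "n + 1 - (n + 1 - j) = j" "j \<in> {1..n}"
    "n + 1 - j \<noteq> j" if "j \<in> J" for j
  proof -
    have "1 \<le> j" "j \<le> n" using that J(1) by auto
    then show "n + 1 - j \<in> {1..n}" "2 * (n + 1 - j) \<noteq> n + 1" "n + 1 - (n + 1 - j) = j" "j \<in> {1..n}"
      "n + 1 - j \<noteq> j"
      using J(2)[OF that] by auto
  qed
  have m: "m \<in> {1..n}" "2 * m = n + 1" if "odd n"
    using that n unfolding m_def by (auto elim!: oddE)
  have block: "matrix_numerical_radius 2 A (B j) \<le> c \<longleftrightarrow> (\<forall>u v. cmod (q j u v) \<le> c * (N u + N v))"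
    if j: "j \<in> J" for j
  proof -
    have two: "{1..2} = {1, 2::nat}" by auto
    have adj: "B j i k \<in> A_adjointable A" for i k
      using T S refl_J[OF j] by (simp add: B_def block2_def)
    have "matrix_numerical_radius 2 A (B j) \<le> c \<longleftrightarrow>
      (\<forall>x\<in>dsum 2. cmod (\<Sum>i = 1..2. \<Sum>k = 1..2. cinner (A (B j i k (x k))) (x i))
        \<le> c * (\<Sum>i = 1..2. Re (cinner (A (x i)) (x i))))"
      by (rule matrix_numerical_radius_le_iff[OF A _ adj z]) simp
    also have "\<dots> \<longleftrightarrow> (\<forall>x\<in>dsum 2. cmod (q j (x 1) (x 2)) \<le> c * (N (x 1) + N (x 2)))"
      by (simp add: two B_def block2_def q_def N_def del: One_nat_def)
    also have "\<dots> \<longleftrightarrow> (\<forall>u v. cmod (q j u v) \<le> c * (N u + N v))"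
    proof (intro iffI allI)
      fix u v :: 'a assume all: "\<forall>x\<in>dsum 2. cmod (q j (x 1) (x 2)) \<le> c * (N (x 1) + N (x 2))"
      have "((\<lambda>_. 0)(1 := u, 2 := v)) \<in> dsum 2" by (simp add: dsum_def)
      from all[rule_format, OF this] show "cmod (q j u v) \<le> c * (N u + N v)" by simp
    qed simp
    finally show ?thesis .
  qed
  have form: "(\<Sum>i = 1..n. \<Sum>j = 1..n. cinner (A (cross_diagonal n T S i j (x j))) (x i)) =
    (\<Sum>j\<in>J. q j (x (n + 1 - j)) (x j)) + (if odd n then cinner (A (T m (x m))) (x m) else 0)" for x
  proof -
    let ?g = "\<lambda>i. cinner (A (T i (x i))) (x i)
        + (if 2 * i = n + 1 then 0 else cinner (A (S i (x (n + 1 - i)))) (x i))"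
    have "(\<Sum>i = 1..n. \<Sum>j = 1..n. cinner (A (cross_diagonal n T S i j (x j))) (x i)) =
      (\<Sum>i = 1..n. ?g i)"
      by (intro sum.cong refl cross_diagonal_row_form[OF A])
    also have "\<dots> = (\<Sum>j\<in>J. ?g (n + 1 - j) + ?g j) + (if odd n then ?g m else 0)"
      unfolding m_def by (rule sum_reflection_representatives[OF J exact])
    also have "\<dots> = (\<Sum>j\<in>J. q j (x (n + 1 - j)) (x j))
        + (if odd n then cinner (A (T m (x m))) (x m) else 0)"
    proof (intro arg_cong2[where f = "(+)"] sum.cong refl)
      fix j assume j: "j \<in> J"
      from refl_J[OF j] J(2)[OF j]
      show "?g (n + 1 - j) + ?g j = q j (x (n + 1 - j)) (x j)"
        by (simp add: q_def)
    qed (use m in auto)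
    finally show ?thesis .
  qed
  have norm_form: "(\<Sum>i = 1..n. Re (cinner (A (x i)) (x i))) =
    (\<Sum>j\<in>J. N (x (n + 1 - j)) + N (x j)) + (if odd n then N (x m) else 0)" for x
    unfolding N_def m_def by (rule sum_reflection_representatives[OF J exact])
  have "cross_diagonal n T S i j \<in> A_adjointable A" if "i \<in> {1..n}" "j \<in> {1..n}" for i j
    using that T S zero_A_adjointable[OF A] by (simp add: cross_diagonal_def)
  then have cross: "matrix_numerical_radius n A (cross_diagonal n T S) \<le> c \<longleftrightarrow>
    (\<forall>x\<in>dsum n. cmod ((\<Sum>j\<in>J. q j (x (n + 1 - j)) (x j))
        + (if odd n then cinner (A (T m (x m))) (x m) else 0))
      \<le> c * ((\<Sum>j\<in>J. N (x (n + 1 - j)) + N (x j)) + (if odd n then N (x m) else 0)))"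
    by (subst matrix_numerical_radius_le_iff[OF A n _ z]) (simp_all only: form norm_form)
  have "finite J" using J(1) finite_subset by blast
  show ?thesis
  proof
    assume "matrix_numerical_radius n A (cross_diagonal n T S) \<le> c"
    note all = this[unfolded cross, rule_format]
    have "cmod (q j u v) \<le> c * (N u + N v)" if j: "j \<in> J" for j u v
    proof -
      define x where "x = (\<lambda>_. 0)(n + 1 - j := u, j := v)"
      have x: "x \<in> dsum n" "x (n + 1 - j) = u" "x j = v"
        using refl_J[OF j] by (auto simp: x_def dsum_def)
      have x0: "x (n + 1 - i) = 0" "x i = 0" if "i \<in> J" "i \<noteq> j" for i
        using that j refl_J[OF j] refl_J[OF that(1)] exact[of i] J(2)[of i] by (auto simp: x_def)
      have xm: "x m = 0" if "odd n"
        using m[OF that] J(2)[OF j] refl_J[OF j] by (auto simp: x_def)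
      have "(\<Sum>i\<in>J. q i (x (n + 1 - i)) (x i)) = (\<Sum>i\<in>J. if i = j then q j u v else 0)"
        using x x0 refl_J by (intro sum.cong) (auto simp: q_def)
      moreover have "(\<Sum>i\<in>J. N (x (n + 1 - i)) + N (x i)) = (\<Sum>i\<in>J. if i = j then N u + N v else 0)"
        using x x0 by (intro sum.cong) (auto simp: N_def)
      ultimately show ?thesis
        using all[OF x(1)] xm j \<open>finite J\<close> by (auto simp: N_def split: if_splits)
    qed
    moreover have "A_numerical_radius A (T m) \<le> c" if "odd n"
    proof -
      have "cmod (cinner (A (T m u)) u) \<le> c * Re (cinner (A u) u)" for u
      proof -
        define x where "x = (\<lambda>_. 0)(m := u)"
        have x: "x \<in> dsum n" "x m = u" using m[OF that] by (auto simp: x_def dsum_def)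
        have x0: "x (n + 1 - i) = 0" "x i = 0" if "i \<in> J" for i
          using m[OF \<open>odd n\<close>] J(2)[OF that] refl_J[OF that] by (auto simp: x_def)
        have "(\<Sum>i\<in>J. q i (x (n + 1 - i)) (x i)) = 0" "(\<Sum>i\<in>J. N (x (n + 1 - i)) + N (x i)) = 0"
          using x0 by (simp_all add: q_def N_def)
        then show ?thesis using all[OF x(1)] that by (simp add: x(2) N_def)
      qed
      then show ?thesis using A_numerical_radius_le_iff[OF A T[OF m(1)[OF that]] z] by blast
    qed
    ultimately show "(\<forall>j\<in>J. matrix_numerical_radius 2 A (B j) \<le> c) \<and>
        (odd n \<longrightarrow> A_numerical_radius A (T m) \<le> c)"
      using block by blast
  next
    assume parts: "(\<forall>j\<in>J. matrix_numerical_radius 2 A (B j) \<le> c) \<and>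
        (odd n \<longrightarrow> A_numerical_radius A (T m) \<le> c)"
    have "cmod ((\<Sum>j\<in>J. q j (x (n + 1 - j)) (x j))
          + (if odd n then cinner (A (T m (x m))) (x m) else 0))
        \<le> (\<Sum>j\<in>J. c * (N (x (n + 1 - j)) + N (x j))) + (if odd n then c * N (x m) else 0)" for x
    proof (rule norm_triangle_mono[OF sum_norm_le])
      show "cmod (q j (x (n + 1 - j)) (x j)) \<le> c * (N (x (n + 1 - j)) + N (x j))" if "j \<in> J" for j
        using parts block that by blast
      show "cmod (if odd n then cinner (A (T m (x m))) (x m) else 0) \<le> (if odd n then c * N (x m) else 0)"
        using parts A_numerical_radius_le_iff[OF A T[OF m(1)] z] by (auto simp: N_def)
    qed
    then show "matrix_numerical_radius n A (cross_diagonal n T S) \<le> c"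
      unfolding cross
      by (simp add: distrib_left sum_distrib_left if_distrib[of "(*) c"] cong: if_cong split del: if_split)
  qed
qed

text \<open>For a nonzero seminorm both sides have the same upper bounds. For the zero seminorm they agree
because all radii coincide and the maximum is not over an empty set: either a pair of reflected
indices or the central index exists.\<close>
lemma cross_diagonal_numerical_radius_eq_Max:
  fixes T S :: "nat \<Rightarrow> 'a::complex_hilbert \<Rightarrow> 'a"
  assumes A: "positive_operator A" and n: "n \<ge> 1"
    and T: "\<And>i. i \<in> {1..n} \<Longrightarrow> T i \<in> A_adjointable A"
    and S: "\<And>i. i \<in> {1..n} \<Longrightarrow> S i \<in> A_adjointable A"
    and J: "J \<subseteq> {1..n}" "\<And>j. j \<in> J \<Longrightarrow> 2 * j \<noteq> n + 1"
    and exact: "\<And>i. i \<in> {1..n} \<Longrightarrow> 2 * i \<noteq> n + 1 \<Longrightarrow> i \<in> J \<longleftrightarrow> n + 1 - i \<notin> J"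
  shows "matrix_numerical_radius n A (cross_diagonal n T S) =
    Max ((\<lambda>j. matrix_numerical_radius 2 A (block2 (T (n + 1 - j)) (S (n + 1 - j)) (S j) (T j))) ` J
      \<union> (if odd n then {A_numerical_radius A (T ((n + 1) div 2))} else {}))"
    (is "?w = Max ?F")
proof -
  have fin: "finite ?F" using J(1) finite_subset by auto
  have "J \<noteq> {} \<or> odd n"
  proof (rule ccontr)
    assume "\<not> (J \<noteq> {} \<or> odd n)"
    moreover from this have "2 * 1 \<noteq> n + 1" by auto
    ultimately show False using exact[of 1] n by auto
  qed
  then have ne: "?F \<noteq> {}" by auto
  show ?thesis
  proof (cases "\<exists>z. Re (cinner (A z) z) > 0")
    case True
    then obtain z where "Re (cinner (A z) z) > 0" ..
    from cross_diagonal_le_iff[OF A n T S J exact this]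
    have "?w \<le> c \<longleftrightarrow> Max ?F \<le> c" for c
      unfolding Max_le_iff[OF fin ne] by auto
    then show ?thesis by (meson order_antisym order_refl)
  next
    case False
    then have deg: "Re (cinner (A x) x) = 0" for x
      using positive_operatorD(2)[OF A] by (metis less_eq_real_def)
    have "?F = {Sup {}}"
      using ne by (auto simp: A_numerical_radius_degenerate[OF deg] matrix_numerical_radius_degenerate[OF deg])
    then show ?thesis by (simp add: matrix_numerical_radius_degenerate[OF deg])
  qed
qed

section \<open>The three parity cases\<close>

theorem theorem2p1:
  fixes A :: "'a::complex_hilbert \<Rightarrow> 'a"
    and T S :: "nat \<Rightarrow> 'a \<Rightarrow> 'a"
    and n :: nat
  assumes "positive_operator A"
    and "n \<ge> 1"
    and "\<And>i. i \<in> {1..n} \<Longrightarrow> T i \<in> A_adjointable A"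
    and "\<And>i. i \<in> {1..n} \<Longrightarrow> S i \<in> A_adjointable A"
    and "odd n \<Longrightarrow> T ((n + 1) div 2) = S ((n + 1) div 2)"
  shows
    "(even n \<longrightarrow>
        matrix_numerical_radius n A (cross_diagonal n T S) =
        Max ((\<lambda>i. matrix_numerical_radius 2 A
                (block2 (T (n - (2*i - 1))) (S (n - (2*i - 1)))
                        (S (2*i))           (T (2*i)))) ` {1..n div 2}))
   \<and> (odd n \<and> odd ((n + 1) div 2) \<longrightarrow>
        matrix_numerical_radius n A (cross_diagonal n T S) =
        Max ((\<lambda>i. matrix_numerical_radius 2 A
                (block2 (T (n - (2*i - 1))) (S (n - (2*i - 1)))
                        (S (2*i))           (T (2*i)))) ` {1..(n - 1) div 4}
             \<union> {A_numerical_radius A (T ((n + 1) div 2))}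
             \<union> (\<lambda>i. matrix_numerical_radius 2 A
                (block2 (T (n - (2*i - 2))) (S (n - (2*i - 2)))
                        (S (2*i - 1))       (T (2*i - 1)))) ` {(n + 7) div 4..(n + 1) div 2}))
   \<and> (odd n \<and> even ((n + 1) div 2) \<longrightarrow>
        matrix_numerical_radius n A (cross_diagonal n T S) =
        Max ((\<lambda>i. matrix_numerical_radius 2 A
                (block2 (T (n - (2*i - 1))) (S (n - (2*i - 1)))
                        (S (2*i))           (T (2*i)))) ` {1..(n - 3) div 4}
             \<union> {A_numerical_radius A (T ((n + 1) div 2))}
             \<union> (\<lambda>i. matrix_numerical_radius 2 A
                (block2 (T (n - (2*i - 2))) (S (n - (2*i - 2)))
                        (S (2*i - 1))       (T (2*i - 1)))) ` {(n + 5) div 4..(n + 1) div 2}))"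
proof (intro conjI impI)
  let ?B = "\<lambda>j. matrix_numerical_radius 2 A (block2 (T (n + 1 - j)) (S (n + 1 - j)) (S j) (T j))"
  have eq_Max: "matrix_numerical_radius n A (cross_diagonal n T S) =
      Max (?B ` J \<union> (if odd n then {A_numerical_radius A (T ((n + 1) div 2))} else {}))"
    if "J \<subseteq> {1..n}" "\<And>j. j \<in> J \<Longrightarrow> 2 * j \<noteq> n + 1"
      "\<And>i. i \<in> {1..n} \<Longrightarrow> 2 * i \<noteq> n + 1 \<Longrightarrow> i \<in> J \<longleftrightarrow> n + 1 - i \<notin> J" for J
    by (rule cross_diagonal_numerical_radius_eq_Max) (fact assms that)+
  have even_index: "(\<lambda>i. matrix_numerical_radius 2 A (block2 (T (n - (2*i - 1))) (S (n - (2*i - 1)))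
      (S (2*i)) (T (2*i)))) ` I = ?B ` (\<lambda>i. 2*i) ` I" if "\<And>i. i \<in> I \<Longrightarrow> i \<ge> 1" for I
    unfolding image_image
  proof (rule image_cong[OF refl])
    fix i assume "i \<in> I"
    then have "n - (2*i - 1) = n + 1 - 2*i" using that[of i] by simp
    then show "matrix_numerical_radius 2 A (block2 (T (n - (2*i - 1))) (S (n - (2*i - 1)))
      (S (2*i)) (T (2*i))) = ?B (2*i)" by (simp only:)
  qed
  have odd_index: "(\<lambda>i. matrix_numerical_radius 2 A (block2 (T (n - (2*i - 2))) (S (n - (2*i - 2)))
      (S (2*i - 1)) (T (2*i - 1)))) ` I = ?B ` (\<lambda>i. 2*i - 1) ` I" if "\<And>i. i \<in> I \<Longrightarrow> i \<ge> 1" for I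
    unfolding image_image
  proof (rule image_cong[OF refl])
    fix i assume "i \<in> I"
    then have "n - (2*i - 2) = n + 1 - (2*i - 1)" using that[of i] by simp
    then show "matrix_numerical_radius 2 A (block2 (T (n - (2*i - 2))) (S (n - (2*i - 2)))
      (S (2*i - 1)) (T (2*i - 1))) = ?B (2*i - 1)" by (simp only:)
  qed
  have even_image: "(\<lambda>i. 2*i) ` {1..k} = {j. even j \<and> 1 \<le> j \<and> j \<le> 2*k}" for k :: nat
    by (auto elim!: evenE)
  have odd_image: "(\<lambda>i. 2*i - 1) ` {l..k} = {j. odd j \<and> 2*l - 1 \<le> j \<and> j \<le> 2*k - 1}"
    if "l \<ge> 1" "k \<ge> 1" for l k :: nat
  proof (intro equalityI subsetI)
    fix j assume "j \<in> {j. odd j \<and> 2*l - 1 \<le> j \<and> j \<le> 2*k - 1}"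
    then have "j = 2 * ((j + 1) div 2) - 1 \<and> (j + 1) div 2 \<in> {l..k}" using that by (auto elim!: oddE)
    then show "j \<in> (\<lambda>i. 2*i - 1) ` {l..k}" by blast
  qed (use that in auto)
  \<comment> \<open>For odd \<open>n\<close> the reflection preserves parity. The blocks listed in the statement represent pairs of
    even indices by the smaller member and pairs of odd indices by the larger one.\<close>
  define J where "J = {j. even j \<and> 1 \<le> j \<and> 2 * j < n + 1} \<union> {j. odd j \<and> j \<le> n \<and> 2 * j > n + 1}"
  have odd_case: "matrix_numerical_radius n A (cross_diagonal n T S) =
      Max (?B ` J \<union> {A_numerical_radius A (T ((n + 1) div 2))})" if "odd n"
  proof -
    have exact: "i \<in> J \<longleftrightarrow> n + 1 - i \<notin> J" if "i \<in> {1..n}" "2 * i \<noteq> n + 1" for i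
    proof -
      have "even (n + 1 - i) \<longleftrightarrow> even i" using \<open>odd n\<close> that by auto
      moreover have "2 * (n + 1 - i) < n + 1 \<longleftrightarrow> \<not> 2 * i < n + 1"
        "2 * (n + 1 - i) > n + 1 \<longleftrightarrow> 2 * i < n + 1" "1 \<le> n + 1 - i" "n + 1 - i \<le> n"
        using that by auto
      ultimately show ?thesis using that unfolding J_def by auto
    qed
    have J: "J \<subseteq> {1..n}" "\<And>j. j \<in> J \<Longrightarrow> 2 * j \<noteq> n + 1" by (auto simp: J_def)
    have "matrix_numerical_radius n A (cross_diagonal n T S) =
        Max (?B ` J \<union> (if odd n then {A_numerical_radius A (T ((n + 1) div 2))} else {}))"
      by (rule eq_Max) (fact J exact)+
    then show ?thesis using that by (simp only: not_False_eq_True if_True)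
  qed
  {
    assume "even n"
    then obtain k where k: "n = 2 * k" ..
    \<comment> \<open>For even \<open>n\<close> the reflection exchanges parities, so the even indices represent all pairs.\<close>
    have exact: "i \<in> {j. even j \<and> 1 \<le> j \<and> j \<le> n} \<longleftrightarrow> n + 1 - i \<notin> {j. even j \<and> 1 \<le> j \<and> j \<le> n}"
      if "i \<in> {1..n}" for i
      using that \<open>even n\<close> by auto
    have J: "{j. even j \<and> 1 \<le> j \<and> j \<le> n} \<subseteq> {1..n}" by auto
    have off_centre: "2 * j \<noteq> n + 1" for j using \<open>even n\<close> by presburger
    have "matrix_numerical_radius n A (cross_diagonal n T S) =
        Max (?B ` {j. even j \<and> 1 \<le> j \<and> j \<le> n}
          \<union> (if odd n then {A_numerical_radius A (T ((n + 1) div 2))} else {}))"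
      by (rule eq_Max) (use J off_centre exact in blast)+
    then
    have "matrix_numerical_radius n A (cross_diagonal n T S) =
        Max (?B ` {j. even j \<and> 1 \<le> j \<and> j \<le> n})"
      using \<open>even n\<close> by (simp only: not_True_eq_False if_False Un_empty_right)
    moreover have "{j. even j \<and> 1 \<le> j \<and> j \<le> n} = (\<lambda>i. 2*i) ` {1..n div 2}"
      unfolding even_image by (simp add: k)
    ultimately show "matrix_numerical_radius n A (cross_diagonal n T S) =
        Max ((\<lambda>i. matrix_numerical_radius 2 A (block2 (T (n - (2*i - 1))) (S (n - (2*i - 1)))
          (S (2*i)) (T (2*i)))) ` {1..n div 2})"
      by (subst even_index, force) (simp only:)
  next
    assume "odd n \<and> odd ((n + 1) div 2)"
    then obtain k where k: "n = 4 * k + 1" by (auto elim!: oddE)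
    have bounds: "(n - 1) div 4 = k" "(n + 7) div 4 = k + 2" "(n + 1) div 2 = 2 * k + 1" by (simp_all add: k)
    have "J = (\<lambda>i. 2*i) ` {1..(n - 1) div 4} \<union> (\<lambda>i. 2*i - 1) ` {(n + 7) div 4..(n + 1) div 2}"
      unfolding bounds even_image
    proof (subst odd_image, simp, simp, rule set_eqI)
      fix j
      show "j \<in> J \<longleftrightarrow> j \<in> {j. even j \<and> 1 \<le> j \<and> j \<le> 2 * k} \<union>
          {j. odd j \<and> 2 * (k + 2) - 1 \<le> j \<and> j \<le> 2 * (2 * k + 1) - 1}"
        by (cases "even j") (auto simp: J_def k elim!: evenE oddE)
    qed
    moreover have "odd n" by (simp add: k)
    ultimately show "matrix_numerical_radius n A (cross_diagonal n T S) =
        Max ((\<lambda>i. matrix_numerical_radius 2 A (block2 (T (n - (2*i - 1))) (S (n - (2*i - 1)))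
            (S (2*i)) (T (2*i)))) ` {1..(n - 1) div 4}
          \<union> {A_numerical_radius A (T ((n + 1) div 2))}
          \<union> (\<lambda>i. matrix_numerical_radius 2 A (block2 (T (n - (2*i - 2))) (S (n - (2*i - 2)))
            (S (2*i - 1)) (T (2*i - 1)))) ` {(n + 7) div 4..(n + 1) div 2})"
      by (subst even_index, force, subst odd_index, force) (simp only: odd_case image_Un Un_ac)
  next
    assume "odd n \<and> even ((n + 1) div 2)"
    then have "n = 4 * (n div 4) + 3" by presburger
    then obtain k where k: "n = 4 * k + 3" ..
    have bounds: "(n - 3) div 4 = k" "(n + 5) div 4 = k + 2" "(n + 1) div 2 = 2 * k + 2" by (simp_all add: k)
    have "J = (\<lambda>i. 2*i) ` {1..(n - 3) div 4} \<union> (\<lambda>i. 2*i - 1) ` {(n + 5) div 4..(n + 1) div 2}"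
      unfolding bounds even_image
    proof (subst odd_image, simp, simp, rule set_eqI)
      fix j
      show "j \<in> J \<longleftrightarrow> j \<in> {j. even j \<and> 1 \<le> j \<and> j \<le> 2 * k} \<union>
          {j. odd j \<and> 2 * (k + 2) - 1 \<le> j \<and> j \<le> 2 * (2 * k + 2) - 1}"
        by (cases "even j") (auto simp: J_def k elim!: evenE oddE)
    qed
    moreover have "odd n" by (simp add: k)
    ultimately show "matrix_numerical_radius n A (cross_diagonal n T S) =
        Max ((\<lambda>i. matrix_numerical_radius 2 A (block2 (T (n - (2*i - 1))) (S (n - (2*i - 1)))
            (S (2*i)) (T (2*i)))) ` {1..(n - 3) div 4}
          \<union> {A_numerical_radius A (T ((n + 1) div 2))}
          \<union> (\<lambda>i. matrix_numerical_radius 2 A (block2 (T (n - (2*i - 2))) (S (n - (2*i - 2)))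
            (S (2*i - 1)) (T (2*i - 1)))) ` {(n + 5) div 4..(n + 1) div 2})"
      by (subst even_index, force, subst odd_index, force) (simp only: odd_case image_Un Un_ac)
  }
qed

end
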